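(* Let $n=4k$ with $k\ge 1$ an integer and $n\ne 16$. Assume that $G$ is a complete edge-colored graph containing no rainbow $n$-cycles. Then $G$ contains no rainbow $(3n-10)$-cycles.
   Context: An edge-colored graph is a graph (possibly infinite) with an arbitrary assignment of a color to each edge. For $m\ge 3$, an $m$-cycle is a closed walk $v_0\to v_1\to\cdots\to v_{m-1}\to v_0$ through $m$ pairwise distinct vertices; it is rainbow if its $m$ edges have pairwise distinct colors. By convention, a $2$-cycle (a single edge traversed twice) is never rainbow. *)

theory Defs
  imports Main
begin

text \<open>An edge-colored graph is given by a vertex set \<open>V\<close>, a set \<open>E\<close> of unordered pairs of
  distinct vertices and a coloring \<open>c\<close>, whose values outside \<open>E\<close> are never inspected.
  None of the sets involved is assumed to be finite.\<close>

definition simple_graph :: "'a set \<Rightarrow> 'a set set \<Rightarrow> bool" where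
  "simple_graph V E \<longleftrightarrow> E \<subseteq> {{u, v} | u v. u \<in> V \<and> v \<in> V \<and> u \<noteq> v}"

definition complete_graph :: "'a set \<Rightarrow> 'a set set \<Rightarrow> bool" where
  "complete_graph V E \<longleftrightarrow>
     simple_graph V E \<and> (\<forall>u\<in>V. \<forall>v\<in>V. u \<noteq> v \<longrightarrow> {u, v} \<in> E)"

definition cycle_edge :: "'a list \<Rightarrow> nat \<Rightarrow> 'a set" where
  "cycle_edge vs i = {vs ! i, vs ! (Suc i mod length vs)}"

text \<open>The closed walk with vertices \<open>vs ! 0, \<dots>, vs ! (m - 1)\<close>. For \<open>m = 2\<close> this is a
  single edge traversed twice.\<close>

definition is_cycle :: "'a set \<Rightarrow> 'a set set \<Rightarrow> nat \<Rightarrow> 'a list \<Rightarrow> bool" where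
  "is_cycle V E m vs \<longleftrightarrow>
     m \<ge> 2 \<and> length vs = m \<and> distinct vs \<and> set vs \<subseteq> V \<and> (\<forall>i<m. cycle_edge vs i \<in> E)"

text \<open>The condition \<open>length vs \<ge> 3\<close> makes explicit the convention that a 2-cycle is never
  rainbow.\<close>

definition is_rainbow :: "('a set \<Rightarrow> 'c) \<Rightarrow> 'a list \<Rightarrow> bool" where
  "is_rainbow c vs \<longleftrightarrow>
     length vs \<ge> 3 \<and> inj_on (\<lambda>i. c (cycle_edge vs i)) {..<length vs}"

definition has_rainbow_cycle ::
    "'a set \<Rightarrow> 'a set set \<Rightarrow> ('a set \<Rightarrow> 'c) \<Rightarrow> nat \<Rightarrow> bool" where
  "has_rainbow_cycle V E c m \<longleftrightarrow> (\<exists>vs. is_cycle V E m vs \<and> is_rainbow c vs)"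

end

theory Submission
  imports Defs
begin

text \<open>Let \<open>v\<close> be a rainbow cycle of length \<open>N = 3n - 10\<close>, indexed periodically by the integers, and
  suppose there is no rainbow \<open>n\<close>-cycle. A rainbow path on \<open>n\<close> vertices then forces the color of its
  closing edge to occur on the path. Applied to an arc, this gives every chord \<open>{v u, v (u + n - 1)}\<close>
  the color of an edge of its arc; applied to paths with two such chords, it shows that, after
  possibly reversing the cycle, this edge is always one of the last three. Call a displacement \<open>D\<close>
  late if every chord \<open>{v u, v (u + D)}\<close> has the color of one of the three edges preceding
  \<open>v (u + D)\<close>. From late chords one builds further rainbow paths, which show that
  \<open>5 + 4a\<close>, \<open>n - 1 + 4a\<close> and \<open>2n - 3 + 4a\<close> are late for \<open>a\<close> up to about \<open>k/2\<close>.
  For even \<open>k\<close> this includes \<open>N/2\<close>, which cannot be late since the chord has two arcs; for odd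
  \<open>k\<close> it yields a rainbow \<open>n\<close>-cycle with three late chords. For \<open>n = 16\<close> the path that would
  show that \<open>5\<close> is late meets the vertex \<open>v (u + 5)\<close> twice.\<close>

section \<open>Rainbow paths along a periodically indexed cycle\<close>

lemma hd_upto [simp]: "i \<le> j \<Longrightarrow> hd [i..j] = i"
  by (simp add: upto_rec1)

lemma last_upto [simp]: "i \<le> j \<Longrightarrow> last [i..j] = j"
  by (simp add: upto_rec2)

text \<open>In a complete graph any \<open>n\<close> distinct vertices in any order form a cycle, so
  \<open>no_rainbow\<close> can speak of lists alone.\<close>

locale rainbow_cyclic =
  fixes c :: "'a set \<Rightarrow> 'c" and v :: "int \<Rightarrow> 'a" and n N k :: int
  assumes N_eq: "N = 3 * n - 10" and n_eq: "n = 4 * k" and k_ge: "k \<ge> 2"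
    and v_eq_iff: "v i = v j \<longleftrightarrow> i mod N = j mod N"
    and edge_color_eq_iff: "c {v i, v (i + 1)} = c {v j, v (j + 1)} \<longleftrightarrow> i mod N = j mod N"
    and no_rainbow: "\<lbrakk>length xs = nat n; distinct xs; set xs \<subseteq> range v\<rbrakk>
      \<Longrightarrow> \<not> inj_on (\<lambda>i. c (cycle_edge xs i)) {..<length xs}"
begin

lemma n_ge: "n \<ge> 8"
  using n_eq k_ge by simp

definition hue :: "int \<Rightarrow> 'c" where
  "hue i = c {v i, v (i + 1)}"

text \<open>The entries of the second list are indices of edges of the cycle \<open>v\<close> having the same colors
  as the steps of the first list.\<close>

definition trail :: "int list \<Rightarrow> int list \<Rightarrow> bool" where
  "trail ps qs \<longleftrightarrow> length ps = Suc (length qs) \<and>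
     (\<forall>i<length qs. c {v (ps ! i), v (ps ! Suc i)} = hue (qs ! i))"

definition late :: "int \<Rightarrow> bool" where
  "late D \<longleftrightarrow> (\<forall>u. \<exists>q\<in>{u + D - 3..u + D - 1}. c {v u, v (u + D)} = hue q)"

lemma v_add_N [simp]: "v (i + N) = v i"
  by (simp add: v_eq_iff)

lemma hue_eqD:
  assumes "hue i = hue j" "\<bar>i - j\<bar> < N"
  shows "i = j"
proof -
  have "N dvd i - j"
    using assms(1) unfolding hue_def edge_color_eq_iff by (simp add: mod_eq_dvd_iff)
  then show ?thesis
    using assms(2) dvd_imp_le_int[of "i - j" N] by force
qed

lemma hue_add_N [simp]: "hue (i + N) = hue i"
  unfolding hue_def edge_color_eq_iff by simp

lemma trail_single [simp]: "trail [p] []"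
  by (simp add: trail_def)

lemma trail_append:
  assumes "trail ps qs" "trail ps' qs'" "c {v (last ps), v (hd ps')} = hue q"
  shows "trail (ps @ ps') (qs @ q # qs')"
proof -
  have len: "length ps = Suc (length qs)" "length ps' = Suc (length qs')"
    using assms by (auto simp: trail_def)
  have "c {v ((ps @ ps') ! i), v ((ps @ ps') ! Suc i)} = hue ((qs @ q # qs') ! i)"
    if "i < length (qs @ q # qs')" for i
  proof -
    consider "i < length qs" | "i = length qs" | "length qs < i"
      by linarith
    then show ?thesis
    proof cases
      case 1
      then show ?thesis
        using assms(1) len by (simp add: trail_def nth_append)
    next
      case 2
      moreover have "last ps = ps ! length qs" "hd ps' = ps' ! 0"
        using len by (auto simp: last_conv_nth hd_conv_nth simp flip: length_greater_0_conv)
      ultimately show ?thesis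
        using assms(3) len by (simp add: nth_append)
    next
      case 3
      then obtain j where "i = Suc (length qs + j)"
        using less_imp_Suc_add by blast
      then show ?thesis
        using assms(2) len that by (simp add: trail_def nth_append)
    qed
  qed
  then show ?thesis
    using len by (simp add: trail_def)
qed

lemma trail_rev:
  assumes "trail ps qs"
  shows "trail (rev ps) (rev qs)"
proof -
  have len: "length ps = Suc (length qs)"
    using assms by (simp add: trail_def)
  have "c {v (rev ps ! i), v (rev ps ! Suc i)} = hue (rev qs ! i)" if "i < length qs" for i
  proof -
    have "Suc (length qs - Suc i) = length qs - i"
      using that by simp
    moreover have "length qs - Suc i < length qs"
      using that by simp
    ultimately have "c {v (ps ! (length qs - Suc i)), v (ps ! (length qs - i))} = hue (qs ! (length qs - Suc i))"
      using assms unfolding trail_def by metis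
    then show ?thesis
      using that len by (simp add: rev_nth insert_commute)
  qed
  then show ?thesis
    using len by (simp add: trail_def)
qed

lemma trail_upto: "a \<le> b \<Longrightarrow> trail [a..b] [a..b - 1]"
  by (auto simp: trail_def hue_def nth_upto algebra_simps)

lemmas trail_downto = trail_rev[OF trail_upto]

text \<open>Otherwise the closing edge would complete a rainbow \<open>n\<close>-cycle:
  \<open>v\<close> and \<open>hue\<close> are injective on any \<open>N\<close> consecutive
  integers.\<close>

lemma trail_closing:
  assumes "trail ps qs" "length ps = nat n"
    and "distinct ps" "set ps \<subseteq> {l..<l + N}"
    and "distinct qs" "set qs \<subseteq> {m..<m + N}"
  shows "\<exists>q\<in>set qs. c {v (hd ps), v (last ps)} = hue q"
proof (rule ccontr)
  assume "\<not> ?thesis"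
  then have no: "c {v (hd ps), v (last ps)} \<noteq> hue (qs ! i)" if "i < length qs" for i
    using that by auto
  define xs where "xs = map v ps"
  have len: "length ps = Suc (length qs)"
    using assms(1) by (simp add: trail_def)
  have v_inj: "inj_on v (set ps)"
  proof (rule inj_onI)
    fix x y assume *: "x \<in> set ps" "y \<in> set ps" "v x = v y"
    then have "N dvd x - y"
      by (simp add: v_eq_iff mod_eq_dvd_iff)
    moreover have "\<bar>x - y\<bar> < N"
      using subsetD[OF assms(4) *(1)] subsetD[OF assms(4) *(2)] by auto
    ultimately show "x = y"
      using dvd_imp_le_int[of "x - y" N] by force
  qed
  have e: "c (cycle_edge xs i) =
      (if i < length qs then hue (qs ! i) else c {v (hd ps), v (last ps)})"
    if "i < length xs" for i
  proof (cases "i < length qs")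
    case True
    then show ?thesis
      using assms(1) len by (simp add: cycle_edge_def xs_def trail_def)
  next
    case False
    then have "i = length qs"
      using that len by (simp add: xs_def)
    moreover have "last ps = ps ! length qs" "hd ps = ps ! 0"
      using len by (auto simp: last_conv_nth hd_conv_nth simp flip: length_greater_0_conv)
    ultimately show ?thesis
      using len by (simp add: cycle_edge_def xs_def insert_commute)
  qed
  have "inj_on (\<lambda>i. c (cycle_edge xs i)) {..<length xs}"
  proof (rule inj_onI)
    fix i j
    assume ij: "i \<in> {..<length xs}" "j \<in> {..<length xs}"
      and eq: "c (cycle_edge xs i) = c (cycle_edge xs j)"
    have "qs ! i = qs ! j" if "i < length qs" "j < length qs"
    proof (rule hue_eqD)
      show "hue (qs ! i) = hue (qs ! j)"
        using eq e ij that by simp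
      show "\<bar>qs ! i - qs ! j\<bar> < N"
        using subsetD[OF assms(6) nth_mem[OF that(1)]] subsetD[OF assms(6) nth_mem[OF that(2)]]
        by auto
    qed
    moreover have "i < length qs \<longleftrightarrow> j < length qs"
      using eq e[of i] e[of j] ij no[of i] no[of j] by (auto split: if_splits)
    moreover have "length xs = Suc (length qs)"
      using len by (simp add: xs_def)
    ultimately show "i = j"
      using ij nth_eq_iff_index_eq[OF assms(5)] by (metis lessThan_iff less_antisym)
  qed
  moreover have "length xs = nat n" "distinct xs" "set xs \<subseteq> range v"
    using assms v_inj by (auto simp: xs_def distinct_map)
  ultimately show False
    using no_rainbow by blast
qed

section \<open>Late displacements\<close>

lemma lateE:
  assumes "late D"
  obtains q where "u + D - 3 \<le> q" "q \<le> u + D - 1" "c {v u, v (u + D)} = hue q"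
  using assms unfolding late_def by (meson atLeastAtMost_iff)

text \<open>Close the new chord up by \<open>x\<close> edges, a chord of displacement \<open>D\<close> and \<open>n - 2 - x\<close> edges. Each
  \<open>x\<close> excludes the colors of the edges from \<open>u + x\<close> to \<open>u + x + D - 4\<close>, and for
  \<open>0 \<le> x \<le> n - 2\<close> these cover everything but the last three.\<close>

lemma late_add:
  assumes D: "late D" "D \<ge> 4" "D + n - 2 < N"
  shows "late (D + n - 2)"
  unfolding late_def
proof
  fix u
  have cl: "\<exists>q. c {v u, v (u + (D + n - 2))} = hue q \<and> u \<le> q \<and> q \<le> u + D + n - 3 \<and>
      (q < u + x \<or> u + x + D - 3 \<le> q)" if x: "0 \<le> x" "x \<le> n - 2" for x
  proof -
    obtain r where r: "u + x + D - 3 \<le> r" "r \<le> u + x + D - 1"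
      "c {v (u + x), v (u + x + D)} = hue r"
      by (rule lateE[OF D(1)])
    let ?ps = "[u..u + x] @ [u + x + D..u + D + n - 2]"
    let ?qs = "[u..u + x - 1] @ r # [u + x + D..u + D + n - 2 - 1]"
    have "trail ?ps ?qs"
      using x r by (intro trail_append trail_upto) auto
    moreover have "length ?ps = nat n" "distinct ?ps" "distinct ?qs"
        "set ?ps \<subseteq> {u..<u + N}" "set ?qs \<subseteq> {u..<u + N}"
      using x r D by auto
    ultimately have "\<exists>q\<in>set ?qs. c {v (hd ?ps), v (last ?ps)} = hue q"
      by (intro trail_closing)
    then show ?thesis
      using x r D by (auto simp: algebra_simps)
  qed
  obtain q where q: "c {v u, v (u + (D + n - 2))} = hue q" "u + D - 3 \<le> q" "q \<le> u + D + n - 3"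
    using cl[of 0] n_ge by auto
  have "q \<ge> u + D + n - 5"
  proof (rule ccontr)
    assume less: "\<not> q \<ge> u + D + n - 5"
    \<comment> \<open>This puts \<open>q\<close> among the edges excluded by \<open>cl\<close>: it
      is the first of them, or \<open>x\<close> is maximal and they reach up to
      \<open>u + D + n - 6\<close>.\<close>
    define x where "x = min (q - u) (n - 2)"
    have x: "0 \<le> x" "x \<le> n - 2"
      using n_ge q D by (auto simp: x_def)
    obtain r where r: "c {v u, v (u + (D + n - 2))} = hue r" "u \<le> r" "r \<le> u + D + n - 3"
        "r < u + x \<or> u + x + D - 3 \<le> r"
      using cl[OF x] by auto
    have "q = r"
      by (rule hue_eqD) (use q r D in auto)
    then show False
      using r less D unfolding x_def by linarith
  qed
  then show "\<exists>q\<in>{u + (D + n - 2) - 3..u + (D + n - 2) - 1}. c {v u, v (u + (D + n - 2))} = hue q"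
    using q by auto
qed

lemma late_minus_N:
  assumes "late D"
  shows "late (D - N)"
  unfolding late_def
proof
  fix u
  obtain q where q: "u + D - 3 \<le> q" "q \<le> u + D - 1" "c {v u, v (u + D)} = hue q"
    by (rule lateE[OF assms])
  moreover have "v (u + (D - N)) = v (u + D)" "hue (q - N) = hue q"
    using v_add_N[of "u + (D - N)"] hue_add_N[of "q - N"] by (simp_all add: algebra_simps)
  ultimately show "\<exists>q\<in>{u + (D - N) - 3..u + (D - N) - 1}. c {v u, v (u + (D - N))} = hue q"
    by (intro bexI[of _ "q - N"]) auto
qed

lemma late_opposite:
  assumes "late D" "2 * D = N"
  shows False
proof -
  obtain q where q: "D - 3 \<le> q" "q \<le> D - 1" "c {v 0, v D} = hue q"
    using lateE[OF assms(1), of 0] by auto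
  obtain r where r: "D + D - 3 \<le> r" "r \<le> D + D - 1" "c {v D, v (D + D)} = hue r"
    by (rule lateE[OF assms(1)])
  have "v (D + D) = v 0"
    using v_add_N[of 0] assms(2) by simp
  then have "hue q = hue r"
    using q r by (simp add: insert_commute)
  then have "q = r"
    by (rule hue_eqD) (use q r assms N_eq n_ge in auto)
  then show False
    using q r assms N_eq n_ge by linarith
qed

lemma late_five_add:
  assumes base: "late (n - 1)" and D: "late (n - 1 + 4 * a)" and a: "0 \<le> a" "a < k - 4"
  shows "late (5 + 4 * a)"
  unfolding late_def
proof
  fix u
  let ?z = "u + (5 + 4 * a)"
  have "late (n - 1 + n - 2)"
    by (rule late_add[OF base]) (use N_eq n_ge in auto)
  then have two: "late (7 - n)"
    using late_minus_N[of "n - 1 + n - 2"] N_eq by simp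
  have one: "late (9 - 2 * n)"
    using late_minus_N[OF base] N_eq by simp
  \<comment> \<open>This \<open>b\<close> gives the path below \<open>n\<close> vertices. Its second
    stretch starts at \<open>u + 2 * k - 3 + 2 * a\<close>, which is beyond \<open>?z\<close>
    exactly when \<open>a < k - 4\<close>.\<close>
  define b where "b = 2 * k - 4 - 2 * a"
  obtain r1 where r1: "u - b - 3 \<le> r1" "r1 \<le> u - b - 1" "c {v (u - b), v (u - b + n - 7)} = hue r1"
    using lateE[OF two, of "u - b + n - 7"] by (auto simp: insert_commute)
  obtain r2 where r2: "?z - 3 \<le> r2" "r2 \<le> ?z - 1" "c {v (u + n - 2 + 4 * a), v ?z} = hue r2"
    using lateE[OF two, of "u + n - 2 + 4 * a"] by (auto simp: algebra_simps)
  \<comment> \<open>Modulo \<open>N\<close>, the two long jumps have displacements \<open>n - 7\<close> and \<open>7 - n\<close>. The edges of this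
    path avoid those of \<open>?ps'\<close> below, which leaves only the three edges before \<open>?z\<close>.\<close>
  let ?ps = "rev [u - b..u] @ [u - b + n - 7..u + n - 2 + 4 * a] @ [?z]"
  let ?qs = "rev [u - b..u - 1] @ r1 # [u - b + n - 7..u + n - 2 + 4 * a - 1] @ r2 # []"
  have "trail ?ps ?qs"
    using a r1 r2 n_ge by (intro trail_append trail_upto trail_downto trail_single)
      (auto simp: b_def hd_rev last_rev)
  moreover have "length ?ps = nat n" "distinct ?ps" "distinct ?qs"
      "set ?ps \<subseteq> {u - b - 3..<u - b - 3 + N}" "set ?qs \<subseteq> {u - b - 3..<u - b - 3 + N}"
    using a r1 r2 n_eq N_eq by (auto simp: b_def)
  ultimately have "\<exists>q\<in>set ?qs. c {v (hd ?ps), v (last ?ps)} = hue q"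
    by (intro trail_closing)
  moreover have "hd ?ps = u" "last ?ps = ?z"
    using a by (auto simp: b_def hd_rev)
  ultimately obtain q where q: "q \<in> set ?qs" "c {v u, v ?z} = hue q"
    by metis
  obtain s1 where s1: "u + n + 1 + 4 * a - 3 \<le> s1" "s1 \<le> u + n + 1 + 4 * a - 1"
    "c {v (u + 2), v (u + n + 1 + 4 * a)} = hue s1"
    using lateE[OF D, of "u + 2"] by (auto simp: algebra_simps)
  obtain s2 where s2: "?z - 3 \<le> s2" "s2 \<le> ?z - 1" "c {v (u + 2 * n - 4 + 4 * a), v ?z} = hue s2"
    using lateE[OF one, of "u + 2 * n - 4 + 4 * a"] by (auto simp: algebra_simps)
  let ?ps' = "[u..u + 2] @ [u + n + 1 + 4 * a..u + 2 * n - 4 + 4 * a] @ [?z]"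
  let ?qs' = "[u..u + 2 - 1] @ s1 # [u + n + 1 + 4 * a..u + 2 * n - 4 + 4 * a - 1] @ s2 # []"
  have "trail ?ps' ?qs'"
    using a s1 s2 n_ge by (intro trail_append trail_upto trail_single) auto
  moreover have "length ?ps' = nat n" "distinct ?ps'" "distinct ?qs'"
      "set ?ps' \<subseteq> {u..<u + N}" "set ?qs' \<subseteq> {u..<u + N}"
    using a s1 s2 n_eq N_eq by auto
  ultimately have "\<exists>q\<in>set ?qs'. c {v (hd ?ps'), v (last ?ps')} = hue q"
    by (intro trail_closing)
  moreover have "hd ?ps' = u" "last ?ps' = ?z"
    by auto
  ultimately obtain s where s: "s \<in> set ?qs'" "c {v u, v ?z} = hue s"
    by metis
  have "q = s"
    by (rule hue_eqD) (use q s r1 r2 s1 s2 a n_eq N_eq in \<open>auto simp: b_def\<close>)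
  then have "q \<in> {?z - 3..?z - 1}"
    using q s r1 r2 s1 s2 a n_eq N_eq by (auto simp: b_def)
  then show "\<exists>q\<in>{?z - 3..?z - 1}. c {v u, v ?z} = hue q"
    using q by blast
qed

text \<open>From \<open>n - 1 + 4 * a\<close> one gets \<open>5 + 4 * a\<close>, and adding
  \<open>n - 2\<close> to that raises \<open>a\<close> by one. The case \<open>a = 0\<close> stands
  apart because \<open>k - 4\<close> may be negative.\<close>

lemma late_family:
  assumes base: "late (n - 1)" and a: "int a = 0 \<or> int a \<le> k - 4"
  shows "late (n - 1 + 4 * int a)"
  using a
proof (induction a)
  case (Suc a)
  have "late (5 + 4 * int a)"
    by (rule late_five_add[OF base Suc.IH]) (use Suc.prems in auto)
  then have "late (5 + 4 * int a + n - 2)"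
    by (rule late_add) (use Suc.prems n_eq N_eq in auto)
  then show ?case
    by (simp add: algebra_simps)
qed (use base in simp)

text \<open>Late chords of displacements \<open>10 * k - 9\<close>, \<open>3 - 6 * k\<close> and
  \<open>n - 1\<close>, together with \<open>n - 3\<close> edges of the cycle, have total
  displacement \<open>N\<close> and form a rainbow \<open>n\<close>-cycle.\<close>

lemma not_late_odd:
  assumes base: "late (n - 1)" and "odd k" "k \<ge> 3"
  shows False
proof -
  define a where "a = nat ((k - 3) div 2)"
  have a: "k = 2 * int a + 3"
    using assms by (auto simp: a_def)
  have D1: "late (n - 1 + 4 * int a)"
    by (rule late_family[OF base]) (use a in auto)
  then have "late (n - 1 + 4 * int a + n - 2)"
    by (rule late_add) (use a n_eq N_eq in auto)
  then have D2: "late (10 * k - 9)"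
    using a n_eq by (simp add: algebra_simps)
  obtain r1 where r1: "10 * k - 12 \<le> r1" "r1 \<le> 10 * k - 10" "c {v 0, v (10 * k - 9)} = hue r1"
    using lateE[OF D2, of 0] by auto
  have "late (3 - 6 * k)"
    using late_minus_N[OF D1] a n_eq N_eq by (simp add: algebra_simps)
  from lateE[OF this, of "10 * k - 9"]
  obtain r2 where r2: "n - 9 \<le> r2" "r2 \<le> n - 7" "c {v (10 * k - 9), v (n - 6)} = hue r2"
    using n_eq by (auto simp: algebra_simps)
  let ?ps = "[0] @ [10 * k - 9] @ [n - 6..2 * n - 9]"
  let ?qs = "[] @ r1 # [] @ r2 # [n - 6..2 * n - 9 - 1]"
  have "trail ?ps ?qs"
    using r1 r2 n_ge by (intro trail_append trail_upto trail_single) auto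
  moreover have "length ?ps = nat n" "distinct ?ps" "distinct ?qs"
      "set ?ps \<subseteq> {0..<0 + N}" "set ?qs \<subseteq> {0..<0 + N}"
    using r1 r2 n_eq N_eq \<open>k \<ge> 3\<close> by auto
  ultimately have "\<exists>q\<in>set ?qs. c {v (hd ?ps), v (last ?ps)} = hue q"
    by (intro trail_closing)
  moreover have "hd ?ps = 0" "last ?ps = 2 * n - 9"
    using n_ge by auto
  ultimately obtain q where q: "q \<in> set ?qs" "c {v 0, v (2 * n - 9)} = hue q"
    by metis
  have "v (2 * n - 9 + (n - 1)) = v 0"
    using v_add_N[of 0] N_eq by simp
  then obtain r where r: "N - 3 \<le> r" "r \<le> N - 1" "c {v 0, v (2 * n - 9)} = hue r"
    using lateE[OF base, of "2 * n - 9"] N_eq by (auto simp: insert_commute)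
  have "q = r"
    by (rule hue_eqD) (use q r r1 r2 n_eq N_eq \<open>k \<ge> 3\<close> in auto)
  then show False
    using q r r1 r2 n_eq N_eq \<open>k \<ge> 3\<close> by auto
qed

lemma not_late:
  assumes "k \<noteq> 4"
  shows "\<not> late (n - 1)"
proof
  assume base: "late (n - 1)"
  show False
  proof (cases "even k")
    case True
    \<comment> \<open>Then \<open>n - 1 + 4 * a = 6 * k - 5\<close> is half of \<open>N\<close>;
      among even \<open>k\<close>, only 4 puts this \<open>a\<close> out of reach of
      \<open>late_family\<close>.\<close>
    define a where "a = nat (k div 2 - 1)"
    have a: "k = 2 * int a + 2"
      using True k_ge by (auto simp: a_def)
    have "late (n - 1 + 4 * int a)"
      by (rule late_family[OF base]) (use a assms in auto)
    then show False
      by (rule late_opposite) (use a n_eq N_eq in auto)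
  next
    case False
    then show False
      using not_late_odd[OF base] k_ge by (cases "k = 2") auto
  qed
qed

section \<open>Chords across \<open>n - 1\<close> edges and the direction of the cycle\<close>

definition high :: "int \<Rightarrow> bool" where
  "high u \<longleftrightarrow> (\<exists>q\<in>{u + n - 4..u + n - 2}. c {v u, v (u + n - 1)} = hue q)"

text \<open>Reversing the cycle exchanges \<open>high\<close> and \<open>low\<close>.\<close>

definition low :: "int \<Rightarrow> bool" where
  "low u \<longleftrightarrow> (\<exists>q\<in>{u..u + 2}. c {v u, v (u + n - 1)} = hue q)"

lemma late_iff_high: "late (n - 1) \<longleftrightarrow> (\<forall>u. high u)"
  by (simp add: late_def high_def algebra_simps)

lemma arc_chord:
  obtains q where "u \<le> q" "q \<le> u + n - 2" "c {v u, v (u + n - 1)} = hue q"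
proof -
  let ?ps = "[u..u + n - 1]" and ?qs = "[u..u + n - 1 - 1]"
  have "trail ?ps ?qs"
    by (rule trail_upto) (use n_ge in auto)
  moreover have "length ?ps = nat n" "distinct ?ps" "distinct ?qs"
      "set ?ps \<subseteq> {u..<u + N}" "set ?qs \<subseteq> {u..<u + N}"
    using n_ge N_eq by auto
  ultimately have "\<exists>q\<in>set ?qs. c {v (hd ?ps), v (last ?ps)} = hue q"
    by (intro trail_closing)
  then show ?thesis
    using that n_ge by auto
qed

text \<open>The chord between \<open>v 0\<close> and \<open>v 7\<close> closes both halves of the
  14-cycle, so its color would occur on each.\<close>

lemma k_ne_2: "k \<noteq> 2"
proof
  assume "k = 2"
  then have N: "N = 14" "n = 8"
    using n_eq N_eq by auto
  obtain q where q: "0 \<le> q" "q \<le> 6" "c {v 0, v 7} = hue q"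
    using arc_chord[of 0] N by auto
  obtain r where r: "7 \<le> r" "r \<le> 13" "c {v 7, v 14} = hue r"
    using arc_chord[of 7] N by auto
  have "v 14 = v 0"
    using v_add_N[of 0] N by simp
  then have "hue q = hue r"
    using q r by (simp add: insert_commute)
  then have "q = r"
    by (rule hue_eqD) (use q r N in auto)
  then show False
    using q r by simp
qed

text \<open>If the chord at \<open>u + n - 4\<close> is not low, it extends to a rainbow path from
  \<open>v (u + n - 1)\<close> to \<open>v (u + N)\<close>. This path and the arc from
  \<open>u\<close> both contain the color of the chord at \<open>u\<close>, and they share just the
  last three edges of the arc.\<close>

lemma high_or_low: "high u \<or> low (u + n - 4)"
proof (rule disjCI)
  assume "\<not> low (u + n - 4)"
  moreover obtain r where r: "u + n - 4 \<le> r" "r \<le> u + n - 4 + n - 2"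
      "c {v (u + n - 4), v (u + n - 4 + n - 1)} = hue r"
    by (rule arc_chord)
  ultimately have r': "u + n - 1 \<le> r"
    unfolding low_def by force
  let ?ps = "rev [u + n - 4..u + n - 1] @ [u + 2 * n - 5..u + N]"
  let ?qs = "rev [u + n - 4..u + n - 1 - 1] @ r # [u + 2 * n - 5..u + N - 1]"
  have "trail ?ps ?qs"
    using r n_ge N_eq by (intro trail_append trail_upto trail_downto)
      (auto simp: last_rev algebra_simps)
  moreover have "length ?ps = nat n" "distinct ?ps" "distinct ?qs"
      "set ?ps \<subseteq> {u + 1..<u + 1 + N}" "set ?qs \<subseteq> {u..<u + N}"
    using r r' n_ge N_eq by auto
  ultimately have "\<exists>q\<in>set ?qs. c {v (hd ?ps), v (last ?ps)} = hue q"
    by (intro trail_closing)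
  moreover have "hd ?ps = u + n - 1" "last ?ps = u + N"
    using n_ge N_eq by (auto simp: hd_rev)
  ultimately obtain q where q: "q \<in> set ?qs" "c {v (u + n - 1), v (u + N)} = hue q"
    by metis
  then have q': "c {v u, v (u + n - 1)} = hue q"
    by (simp add: insert_commute)
  obtain s where s: "u \<le> s" "s \<le> u + n - 2" "c {v u, v (u + n - 1)} = hue s"
    by (rule arc_chord)
  have "q = s"
    by (rule hue_eqD) (use q q' s r r' n_ge N_eq in auto)
  then show "high u"
    using q s r' n_ge unfolding high_def by auto
qed

lemma not_high_if_low:
  assumes "low u"
  shows "\<not> high u"
proof
  assume "high u"
  then obtain q r where qr: "u + n - 4 \<le> q" "q \<le> u + n - 2" "u \<le> r" "r \<le> u + 2" "hue q = hue r"
    using assms by (auto simp: high_def low_def)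
  have "q = r"
    by (rule hue_eqD) (use qr n_ge N_eq in auto)
  then show False
    using qr n_ge by simp
qed

lemma not_high_add: "\<not> high u \<Longrightarrow> \<not> high (u + n - 4)"
  using high_or_low not_high_if_low by blast

lemma high_add_N: "high (u + N) \<longleftrightarrow> high u"
proof -
  have "{u + N + n - 4..u + N + n - 2} = (\<lambda>q. q + N) ` {u + n - 4..u + n - 2}"
    by (simp add: algebra_simps)
  moreover have "v (u + N + n - 1) = v (u + n - 1)"
    using v_add_N[of "u + n - 1"] by (simp add: algebra_simps)
  ultimately show ?thesis
    by (simp only: high_def bex_simps hue_add_N v_add_N)
qed

lemma not_high_diff: "\<not> high u \<Longrightarrow> \<not> high (u - 2 * int r)"
proof (induction r)
  case (Suc r)
  \<comment> \<open>three steps of length \<open>n - 4\<close> amount to \<open>-2\<close> modulo \<open>N\<close>\<close>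
  have "u - 2 * int (Suc r) + N = u - 2 * int r + n - 4 + n - 4 + n - 4"
    by (simp add: N_eq)
  then show ?case
    using Suc not_high_add high_add_N by metis
qed simp

lemma not_high_same_parity:
  assumes "\<not> high u" "even (w - u)"
  shows "\<not> high w"
proof (cases "w \<le> u")
  case True
  have "w = u - 2 * int (nat ((u - w) div 2))"
    using True assms(2) by auto
  then show ?thesis
    using not_high_diff[OF assms(1)] by metis
next
  case False
  \<comment> \<open>Whole periods bring \<open>w\<close> down to at most \<open>u\<close>; as
    \<open>N\<close> is even, the parity is kept.\<close>
  define m where "m = nat (w - u)"
  have per: "high (w - N * int m) \<longleftrightarrow> high w" for m
  proof (induction m)
    case (Suc m)
    then show ?case
      using high_add_N[of "w - N * int (Suc m)"] by (simp add: algebra_simps)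
  qed simp
  have "int m = w - u"
    using False by (simp add: m_def)
  moreover have "1 * int m \<le> N * int m"
    by (rule mult_right_mono) (use N_eq n_ge in auto)
  ultimately have le: "w - N * int m \<le> u"
    by linarith
  have "even (u - (w - N * int m))"
    using assms(2) N_eq n_eq by auto
  then have "w - N * int m = u - 2 * int (nat ((u - (w - N * int m)) div 2))"
    using le by auto
  then show ?thesis
    using not_high_diff[OF assms(1)] per by metis
qed

text \<open>The path goes forward from \<open>v (u + n - 1)\<close>, back along the low chord and
  down to \<open>v u\<close>. For \<open>k \<ge> 3\<close> it avoids the last three edges of the
  arc, so the high chord would close it to a rainbow \<open>n\<close>-cycle.\<close>

lemma not_high_low:
  assumes "high u" "low (u + 2 * k - 1)"
  shows False
proof -
  have k: "k \<ge> 3"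
    using k_ge k_ne_2 by simp
  obtain r where r: "u + 2 * k - 1 \<le> r" "r \<le> u + 2 * k - 1 + 2"
      "c {v (u + 2 * k - 1), v (u + 2 * k - 1 + n - 1)} = hue r"
    using assms(2) unfolding low_def by auto
  let ?ps = "[u + n - 1..u + 2 * k - 1 + n - 1] @ rev [u..u + 2 * k - 1]"
  let ?qs = "[u + n - 1..u + 2 * k - 1 + n - 1 - 1] @ r # rev [u..u + 2 * k - 1 - 1]"
  have "trail ?ps ?qs"
    using r k by (intro trail_append trail_upto trail_downto) (auto simp: hd_rev insert_commute)
  moreover have "length ?ps = nat n" "distinct ?ps" "distinct ?qs"
      "set ?ps \<subseteq> {u..<u + N}" "set ?qs \<subseteq> {u..<u + N}"
    using r k n_eq N_eq by auto
  ultimately have "\<exists>q\<in>set ?qs. c {v (hd ?ps), v (last ?ps)} = hue q"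
    by (intro trail_closing)
  moreover have "hd ?ps = u + n - 1" "last ?ps = u"
    using k by (auto simp: last_rev)
  ultimately obtain q where q: "q \<in> set ?qs" "c {v (u + n - 1), v u} = hue q"
    by metis
  then have q': "c {v u, v (u + n - 1)} = hue q"
    by (simp add: insert_commute)
  obtain s where s: "u + n - 4 \<le> s" "s \<le> u + n - 2" "c {v u, v (u + n - 1)} = hue s"
    using assms(1) by (auto simp: high_def)
  have "q = s"
    by (rule hue_eqD) (use q q' s r k n_eq N_eq in auto)
  then show False
    using q s r k n_eq by auto
qed

text \<open>Failure of \<open>high\<close> spreads within a parity class, and it crosses to the
  other class since \<open>2 * k - 1\<close> in \<open>not_high_low\<close> is odd while
  \<open>n - 4\<close> is even.\<close>

lemma all_high_or_all_low: "(\<forall>u. high u) \<or> (\<forall>u. low u)"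
proof (rule disjCI)
  assume "\<not> (\<forall>u. low u)"
  then obtain w where "\<not> low (w + n - 4)"
    by (metis diff_add_cancel add_diff_eq)
  have "\<not> high x" if "\<not> high u" for u x
  proof (cases "even (x - u)")
    case True
    then show ?thesis
      using not_high_same_parity that by blast
  next
    case False
    then have "even (x + 2 * k - 1 - n + 4 - u)"
      using n_eq by auto
    then have "\<not> high (x + 2 * k - 1 - n + 4)"
      using not_high_same_parity that by blast
    then have "low (x + 2 * k - 1)"
      using high_or_low[of "x + 2 * k - 1 - n + 4"] by simp
    then show ?thesis
      using not_high_low by blast
  qed
  then show "\<forall>u. high u"
    using high_or_low \<open>\<not> low (w + n - 4)\<close> by blast
qed

section \<open>Reversing the cycle and returning to the graph\<close>

lemma reflect: "rainbow_cyclic c (\<lambda>i. v (- i)) n N k"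
proof
  show "v (- i) = v (- j) \<longleftrightarrow> i mod N = j mod N" for i j
    by (simp add: v_eq_iff mod_eq_dvd_iff dvd_diff_commute)
  show "c {v (- i), v (- (i + 1))} = c {v (- j), v (- (j + 1))} \<longleftrightarrow> i mod N = j mod N" for i j
    using edge_color_eq_iff[of "- i - 1" "- j - 1"]
    by (simp add: insert_commute mod_eq_dvd_iff dvd_diff_commute)
  show "\<lbrakk>length xs = nat n; distinct xs; set xs \<subseteq> range (\<lambda>i. v (- i))\<rbrakk>
      \<Longrightarrow> \<not> inj_on (\<lambda>i. c (cycle_edge xs i)) {..<length xs}" for xs
    by (rule no_rainbow) auto
qed (use N_eq n_eq k_ge in auto)

end

text \<open>In one of the two directions all chords are high, so that \<open>n - 1\<close> is late
  there, against \<open>not_late\<close>.\<close>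

lemma (in rainbow_cyclic) k_eq_4: "k = 4"
proof (rule ccontr)
  assume k: "k \<noteq> 4"
  interpret R: rainbow_cyclic c "\<lambda>i. v (- i)" n N k
    by (rule reflect)
  have "R.high u" if low: "\<forall>u. low u" for u
  proof -
    obtain q where q: "- u - n + 1 \<le> q" "q \<le> - u - n + 3" "c {v (- u - n + 1), v (- u)} = hue q"
      using low[rule_format, of "- u - n + 1"] by (auto simp: low_def)
    \<comment> \<open>Reversal turns the edge from \<open>q\<close> to \<open>q + 1\<close> into
      that from \<open>- q - 1\<close> to \<open>- q\<close>.\<close>
    have "R.hue (- q - 1) = hue q"
      by (simp add: R.hue_def hue_def insert_commute add.commute)
    then show ?thesis
      using q by (auto simp: R.high_def insert_commute algebra_simps intro!: bexI[of _ "- q - 1"])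
  qed
  then show False
    using all_high_or_all_low not_late[OF k] R.not_late[OF k] late_iff_high R.late_iff_high by blast
qed

theorem theorem4p4:
  fixes V :: "'a set" and E :: "'a set set" and c :: "'a set \<Rightarrow> 'c" and n k :: nat
  assumes "k \<ge> 1" and "n = 4 * k" and "n \<noteq> 16"
    and "complete_graph V E"
    and "\<not> has_rainbow_cycle V E c n"
  shows "\<not> has_rainbow_cycle V E c (3 * n - 10)"
proof
  assume "has_rainbow_cycle V E c (3 * n - 10)"
  then obtain vs where vs: "length vs = 3 * n - 10" "distinct vs" "set vs \<subseteq> V" "length vs \<ge> 3"
      and inj: "inj_on (\<lambda>i. c (cycle_edge vs i)) {..<length vs}"
    by (auto simp: has_rainbow_cycle_def is_cycle_def is_rainbow_def)
  \<comment> \<open>For \<open>k = 1\<close> the length \<open>3 * n - 10\<close> is 2, and a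
    2-cycle is never rainbow.\<close>
  have k: "k \<ge> 2"
    using vs assms by auto
  define N where "N = 3 * int n - 10"
  have N: "N = int (length vs)" "N > 0"
    using vs k assms by (auto simp: N_def)
  define v where "v i = vs ! nat (i mod N)" for i
  have lt: "nat (i mod N) < length vs" for i
    using N by (simp add: nat_less_iff)
  have nat_eq: "nat (i mod N) = nat (j mod N) \<longleftrightarrow> i mod N = j mod N" for i j
    using N by (simp add: eq_nat_nat_iff)
  have v_in: "v i \<in> V" for i
    using lt vs by (auto simp: v_def)
  have edge: "{v i, v (i + 1)} = cycle_edge vs (nat (i mod N))" for i
  proof -
    have "int (Suc (nat (i mod N)) mod length vs) = (i + 1) mod N"
      using N by (simp add: zmod_int mod_simps add.commute)
    then have "nat ((i + 1) mod N) = Suc (nat (i mod N)) mod length vs"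
      by linarith
    then show ?thesis
      by (simp add: v_def cycle_edge_def)
  qed
  interpret rainbow_cyclic c v "int n" N "int k"
  proof
    show "v i = v j \<longleftrightarrow> i mod N = j mod N" for i j
      using nth_eq_iff_index_eq[OF vs(2) lt lt] nat_eq by (simp add: v_def)
    show "c {v i, v (i + 1)} = c {v j, v (j + 1)} \<longleftrightarrow> i mod N = j mod N" for i j
      using inj_on_eq_iff[OF inj, of "nat (i mod N)" "nat (j mod N)"] lt nat_eq
      unfolding edge by simp
    show "\<not> inj_on (\<lambda>i. c (cycle_edge xs i)) {..<length xs}"
      if xs: "length xs = nat (int n)" "distinct xs" "set xs \<subseteq> range v" for xs
    proof
      assume inj_xs: "inj_on (\<lambda>i. c (cycle_edge xs i)) {..<length xs}"
      have sub: "set xs \<subseteq> V"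
        using xs(3) v_in by blast
      have "cycle_edge xs i \<in> E" if "i < n" for i
      proof -
        have i: "i < length xs" "Suc i mod length xs < length xs" "Suc i mod length xs \<noteq> i"
          using that xs k assms(2) by (auto simp: mod_Suc)
        then have "xs ! i \<noteq> xs ! (Suc i mod length xs)"
          using xs(2) nth_eq_iff_index_eq by metis
        moreover have "xs ! i \<in> V" "xs ! (Suc i mod length xs) \<in> V"
          using i sub nth_mem by blast+
        ultimately show ?thesis
          using assms(4) by (auto simp: complete_graph_def cycle_edge_def)
      qed
      then have "is_cycle V E n xs" "is_rainbow c xs"
        using xs sub inj_xs k assms(2) by (auto simp: is_cycle_def is_rainbow_def)
      then show False
        using assms(5) by (auto simp: has_rainbow_cycle_def)
    qed
  qed (use N_def k assms(2) in auto)
  show False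
    using k_eq_4 assms(2,3) by simp
qed

end
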